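(* For $n\geq 1$ let $\mu(n)$ denote the degree of the variant $\mathcal T_n^a$ where $a\in\mathcal T_n$ has rank $1$. For any integer $k\geq 2$ we have $\mu(n)\geq n+k$ for all integers $n\geq\lceil k\ln k\rceil+1$.
   Context: $\mathcal T_n$ is the full transformation semigroup on $\{1,\dots,n\}$; the rank of a transformation is the size of its image. The variant $\mathcal T_n^a$ is the set $\mathcal T_n$ with operation $f\star g=fag$. The degree of a finite semigroup $S$ is the least $m\geq1$ such that $S$ embeds in $\mathcal T_m$. The degree of $\mathcal T_n^a$ does not depend on the choice of the rank-$1$ map $a$. *)

theory Defs
  imports Complex_Main "HOL-Library.FuncSet"
begin

definition full_transf :: "nat \<Rightarrow> (nat \<Rightarrow> nat) set" where
  "full_transf n = {1..n} \<rightarrow>\<^sub>E {1..n}"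

(* Transformations act on the right: the product fg applies f first. *)
definition transf_mult :: "nat \<Rightarrow> (nat \<Rightarrow> nat) \<Rightarrow> (nat \<Rightarrow> nat) \<Rightarrow> nat \<Rightarrow> nat" where
  "transf_mult n f g = compose {1..n} g f"

definition transf_rank :: "nat \<Rightarrow> (nat \<Rightarrow> nat) \<Rightarrow> nat" where
  "transf_rank n f = card (f ` {1..n})"

definition variant_mult ::
    "nat \<Rightarrow> (nat \<Rightarrow> nat) \<Rightarrow> (nat \<Rightarrow> nat) \<Rightarrow> (nat \<Rightarrow> nat) \<Rightarrow> nat \<Rightarrow> nat" where
  "variant_mult n a f g = transf_mult n (transf_mult n f a) g"

(* A semigroup is given by its carrier S and its operation; HOL-Algebra structures
   with a multiplication also carry a unit, which a variant need not have. *)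
definition semigroup_embedding ::
    "'a set \<Rightarrow> ('a \<Rightarrow> 'a \<Rightarrow> 'a) \<Rightarrow> 'b set \<Rightarrow> ('b \<Rightarrow> 'b \<Rightarrow> 'b) \<Rightarrow> ('a \<Rightarrow> 'b) \<Rightarrow> bool" where
  "semigroup_embedding S mS T mT h \<longleftrightarrow>
     h \<in> S \<rightarrow> T \<and> inj_on h S \<and> (\<forall>x\<in>S. \<forall>y\<in>S. h (mS x y) = mT (h x) (h y))"

(* The least element exists whenever S is a finite semigroup, by Cayley's theorem. *)
definition semigroup_degree :: "'a set \<Rightarrow> ('a \<Rightarrow> 'a \<Rightarrow> 'a) \<Rightarrow> nat" where
  "semigroup_degree S mS =
     (LEAST m. 1 \<le> m \<and> (\<exists>h. semigroup_embedding S mS (full_transf m) (transf_mult m) h))"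

end

theory Submission
  imports Defs
begin

text \<open>
  If \<open>a\<close> is constant with value \<open>c\<close>, then \<open>f \<star> g\<close> is the constant map with value \<open>g c\<close>, so the
  \<open>n ^ (n - 1)\<close> maps \<open>g\<close> with a prescribed value at \<open>c\<close> all have the same right translation.
  Let \<open>h\<close> embed the variant in the transformations of \<open>{1..m}\<close>, and let \<open>Y\<close> be the union of the
  images of all \<open>h f\<close>. The value of \<open>h g\<close> at a point \<open>h f x\<close> of \<open>Y\<close> is that of \<open>h (f \<star> g)\<close> at \<open>x\<close>,
  so these \<open>g\<close> are separated by the restrictions of \<open>h g\<close> to the complement of \<open>Y\<close>, which take
  values in \<open>Y\<close>. Hence \<open>n ^ (n - 1) \<le> p ^ q\<close> with \<open>p + q = m\<close>.

  For \<open>k ln k \<le> n - 1\<close> this is impossible when \<open>m < n + k\<close>: by \<open>ln x - ln y \<le> (x - y) / y\<close>, moving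
  \<open>d\<close> units from base to exponent does not increase \<open>k ^ (n - 1)\<close>, and moving \<open>d\<close> units from
  exponent to base does not increase a power of \<open>n\<close> with exponent at most \<open>n\<close>.
\<close>

subsection \<open>The degree of a finite semigroup\<close>

definition semigroup_on :: "'a set \<Rightarrow> ('a \<Rightarrow> 'a \<Rightarrow> 'a) \<Rightarrow> bool" where
  "semigroup_on S mS \<longleftrightarrow>
     (\<forall>x\<in>S. \<forall>y\<in>S. mS x y \<in> S) \<and>
     (\<forall>x\<in>S. \<forall>y\<in>S. \<forall>z\<in>S. mS (mS x y) z = mS x (mS y z))"

lemma faithful_right_action_embeds_full_transf:
  assumes fin: "finite X"
    and closed: "\<And>x s. x \<in> X \<Longrightarrow> s \<in> S \<Longrightarrow> act x s \<in> X"
    and act_mult: "\<And>x s t. x \<in> X \<Longrightarrow> s \<in> S \<Longrightarrow> t \<in> S \<Longrightarrow> act x (mS s t) = act (act x s) t"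
    and faithful: "\<And>s t. s \<in> S \<Longrightarrow> t \<in> S \<Longrightarrow> (\<And>x. x \<in> X \<Longrightarrow> act x s = act x t) \<Longrightarrow> s = t"
  shows "\<exists>h. semigroup_embedding S mS (full_transf (card X)) (transf_mult (card X)) h"
proof -
  obtain e where e: "bij_betw e {1..card X} X"
    using ex_bij_betw_nat_finite_1[OF fin] by blast
  define b where "b = inv_into {1..card X} e"
  have b: "bij_betw b X {1..card X}"
    unfolding b_def by (rule bij_betw_inv_into[OF e])
  have e_b: "e (b x) = x" if "x \<in> X" for x
    unfolding b_def using e that by (rule bij_betw_inv_into_right)
  have b_range: "b x \<in> {1..card X}" if "x \<in> X" for x
    using b that by (rule bij_betw_apply)
  have e_range: "e i \<in> X" if "i \<in> {1..card X}" for i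
    using e that by (rule bij_betw_apply)
  define h where "h s = (\<lambda>i\<in>{1..card X}. b (act (e i) s))" for s
  have h_b: "h s (b x) = b (act x s)" if "x \<in> X" for s x
    using b_range[OF that] e_b[OF that] by (simp add: h_def)
  have "h \<in> S \<rightarrow> full_transf (card X)"
    unfolding full_transf_def h_def using b_range closed e_range by auto
  moreover have "inj_on h S"
  proof (rule inj_onI)
    fix s t assume st: "s \<in> S" "t \<in> S" and "h s = h t"
    then have "b (act x s) = b (act x t)" if "x \<in> X" for x
      using h_b[OF that] by metis
    then have "act x s = act x t" if "x \<in> X" for x
      using that closed st e_b by metis
    then show "s = t"
      using faithful[OF st] by blast
  qed
  moreover have "h (mS s t) = transf_mult (card X) (h s) (h t)" if st: "s \<in> S" "t \<in> S" for s t
  proof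
    fix i
    have "h t (h s i) = h (mS s t) i" if "i \<in> {1..card X}"
      using that st e_range[OF that]
      by (simp add: h_def[of s] h_def[of "mS s t"] h_b closed act_mult)
    then show "h (mS s t) i = transf_mult (card X) (h s) (h t) i"
      by (simp add: transf_mult_def compose_def h_def[of "mS s t"])
  qed
  ultimately show ?thesis
    unfolding semigroup_embedding_def by blast
qed

lemma finite_semigroup_embeds_full_transf:
  assumes S: "semigroup_on S mS" and fin: "finite S"
  shows "\<exists>h. semigroup_embedding S mS (full_transf (Suc (card S))) (transf_mult (Suc (card S))) h"
proof -
  \<comment> \<open>\<open>S\<close> need not act faithfully on itself, so an identity \<open>None\<close> is adjoined.\<close>
  let ?X = "insert None (Some ` S)"
  define act where "act x s = Some (case x of None \<Rightarrow> s | Some y \<Rightarrow> mS y s)" for x s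
  have "\<exists>h. semigroup_embedding S mS (full_transf (card ?X)) (transf_mult (card ?X)) h"
  proof (rule faithful_right_action_embeds_full_transf)
    show "act x s \<in> ?X" if "x \<in> ?X" "s \<in> S" for x s
      using S that by (auto simp: act_def semigroup_on_def)
    show "act x (mS s t) = act (act x s) t" if "x \<in> ?X" "s \<in> S" "t \<in> S" for x s t
      using S that by (auto simp: act_def semigroup_on_def)
    show "s = t" if "\<And>x. x \<in> ?X \<Longrightarrow> act x s = act x t" for s t
      using that[of None] by (simp add: act_def)
  qed (use fin in simp)
  then show ?thesis
    using fin by (simp add: card_image)
qed

lemma semigroup_degree_embedding:
  assumes "semigroup_on S mS" "finite S"
  obtains h where "semigroup_embedding S mS (full_transf (semigroup_degree S mS))
                     (transf_mult (semigroup_degree S mS)) h"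
proof -
  let ?P = "\<lambda>m. 1 \<le> m \<and> (\<exists>h. semigroup_embedding S mS (full_transf m) (transf_mult m) h)"
  have "?P (Suc (card S))"
    using finite_semigroup_embeds_full_transf[OF assms] by simp
  then have "?P (semigroup_degree S mS)"
    unfolding semigroup_degree_def by (rule LeastI)
  then show thesis
    using that by blast
qed

subsection \<open>Elements with the same right translation\<close>

lemma card_PiE_agreeing_on_le:
  assumes "finite X" "finite Z" "F \<subseteq> X \<rightarrow>\<^sub>E Z"
    and agree: "\<And>f g y. f \<in> F \<Longrightarrow> g \<in> F \<Longrightarrow> y \<in> Y \<Longrightarrow> f y = g y"
  shows "card F \<le> card Z ^ card (X - Y)"
proof -
  have "inj_on (\<lambda>f. restrict f (X - Y)) F"
  proof (rule inj_onI)
    fix f g assume fg: "f \<in> F" "g \<in> F" and eq: "restrict f (X - Y) = restrict g (X - Y)"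
    have "f x = g x" if "x \<in> X" for x
      using agree[OF fg, of x] fun_cong[OF eq, of x] that by (cases "x \<in> Y") simp_all
    then show "f = g"
      using fg assms(3) by (intro PiE_ext[of f X "\<lambda>_. Z" g]) auto
  qed
  moreover have "(\<lambda>f. restrict f (X - Y)) ` F \<subseteq> (X - Y) \<rightarrow>\<^sub>E Z"
    using assms(3) by (fastforce simp: PiE_iff)
  ultimately have "card F \<le> card ((X - Y) \<rightarrow>\<^sub>E Z)"
    using assms(1,2) by (intro card_inj_on_le finite_PiE) auto
  then show ?thesis
    using assms(1) by (simp add: card_funcsetE)
qed

lemma embedding_card_same_right_translation_le:
  assumes h: "semigroup_embedding S mS (full_transf m) (transf_mult m) h"
    and F: "F \<subseteq> S"
    and same: "\<And>x f g. x \<in> S \<Longrightarrow> f \<in> F \<Longrightarrow> g \<in> F \<Longrightarrow> mS x f = mS x g"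
  obtains p q where "p + q = m" "card F \<le> p ^ q"
proof
  define Y where "Y = (\<Union>s\<in>S. h s ` {1..m})"
  have h_transf: "h s \<in> {1..m} \<rightarrow>\<^sub>E {1..m}" if "s \<in> S" for s
    using h that unfolding semigroup_embedding_def full_transf_def by blast
  have Y: "Y \<subseteq> {1..m}"
    using h_transf unfolding Y_def by blast
  then have finY: "finite Y"
    by (rule finite_subset) simp
  have "h s \<in> {1..m} \<rightarrow>\<^sub>E Y" if "s \<in> S" for s
    using h_transf[OF that] that unfolding Y_def by (auto simp: PiE_iff)
  then have h_F: "h ` F \<subseteq> {1..m} \<rightarrow>\<^sub>E Y"
    using F by blast
  have agree: "h f y = h g y" if "f \<in> F" "g \<in> F" "y \<in> Y" for f g y
  proof -
    obtain s x where sx: "s \<in> S" "x \<in> {1..m}" "y = h s x"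
      using \<open>y \<in> Y\<close> unfolding Y_def by blast
    have "h u y = h (mS s u) x" if "u \<in> F" for u
    proof -
      have "h (mS s u) = transf_mult m (h s) (h u)"
        using h sx(1) F that unfolding semigroup_embedding_def by blast
      then show ?thesis
        using sx(2,3) by (simp add: transf_mult_def compose_eq)
    qed
    then show ?thesis
      using that same[OF sx(1)] by metis
  qed
  have "card (h ` F) \<le> card Y ^ card ({1..m} - Y)"
  proof (rule card_PiE_agreeing_on_le[OF _ finY h_F])
    show "u y = v y" if "u \<in> h ` F" "v \<in> h ` F" "y \<in> Y" for u v y
      using that agree by blast
  qed simp
  moreover have "inj_on h F"
    using h F inj_on_subset unfolding semigroup_embedding_def by blast
  ultimately show "card F \<le> card Y ^ card ({1..m} - Y)"
    by (simp add: card_image)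
  show "card Y + card ({1..m} - Y) = m"
    using card_Diff_subset[OF finY Y] card_mono[OF _ Y] by simp
qed

subsection \<open>Variants of the full transformation semigroup\<close>

lemma transf_mult_in_full_transf:
  "f \<in> full_transf n \<Longrightarrow> g \<in> full_transf n \<Longrightarrow> transf_mult n f g \<in> full_transf n"
  by (auto simp: full_transf_def transf_mult_def PiE_iff compose_eq)

lemma transf_mult_assoc:
  "f \<in> full_transf n \<Longrightarrow>
     transf_mult n (transf_mult n f g) u = transf_mult n f (transf_mult n g u)"
  unfolding full_transf_def transf_mult_def by (blast intro: compose_assoc)

lemma semigroup_on_variant:
  assumes "a \<in> full_transf n"
  shows "semigroup_on (full_transf n) (variant_mult n a)"
  using assms unfolding semigroup_on_def variant_mult_def
  by (simp add: transf_mult_in_full_transf transf_mult_assoc)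

lemma transf_rank_1E:
  assumes "a \<in> full_transf n" "transf_rank n a = 1"
  obtains c where "c \<in> {1..n}" "a = (\<lambda>x\<in>{1..n}. c)"
proof -
  obtain c where c: "a ` {1..n} = {c}"
    using assms(2) unfolding transf_rank_def by (auto simp: card_1_singleton_iff)
  have "a ` {1..n} \<subseteq> {1..n}"
    using assms(1) unfolding full_transf_def by blast
  moreover have "a \<in> {1..n} \<rightarrow>\<^sub>E {c}"
    using assms(1) c unfolding full_transf_def PiE_iff by blast
  ultimately show thesis
    using that[of c] c by simp
qed

lemma variant_mult_const:
  assumes "f \<in> full_transf n"
  shows "variant_mult n (\<lambda>x\<in>{1..n}. c) f g = (\<lambda>x\<in>{1..n}. g c)"
  using assms
  by (auto simp: variant_mult_def transf_mult_def compose_def full_transf_def PiE_iff)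

lemma card_PiE_prescribed_value:
  assumes "finite A" "c \<in> A" "d \<in> B"
  shows "card {f \<in> A \<rightarrow>\<^sub>E B. f c = d} = card B ^ (card A - 1)"
proof -
  have "{f \<in> A \<rightarrow>\<^sub>E B. f c = d} = (\<Pi>\<^sub>E x\<in>A. if x = c then {d} else B)"
    using assms(2,3) by (auto simp: PiE_iff extensional_def split: if_splits)
  also have "card \<dots> = (\<Prod>x\<in>A. if x = c then 1 else card B)"
    using assms(1) by (auto simp: card_PiE intro!: prod.cong)
  also have "\<dots> = card B ^ (card A - 1)"
    using assms(1,2) by (simp add: prod.remove[of A c] prod.If_cases[of "A - {c}"])
  finally show ?thesis .
qed

lemma rank_1_variant_embedding_bound:
  assumes a: "a \<in> full_transf n" "transf_rank n a = 1"
    and h: "semigroup_embedding (full_transf n) (variant_mult n a)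
              (full_transf m) (transf_mult m) h"
  obtains p q where "p + q = m" "n ^ (n - 1) \<le> p ^ q"
proof -
  obtain c where c: "c \<in> {1..n}" and a_const: "a = (\<lambda>x\<in>{1..n}. c)"
    using transf_rank_1E[OF a] .
  let ?F = "{g \<in> full_transf n. g c = c}"
  have "variant_mult n a x f = variant_mult n a x g"
    if "x \<in> full_transf n" "f \<in> ?F" "g \<in> ?F" for x f g
    using that by (simp add: a_const variant_mult_const del: One_nat_def)
  then obtain p q where "p + q = m" "card ?F \<le> p ^ q"
    using embedding_card_same_right_translation_le[OF h, of ?F] by blast
  moreover have "card ?F = n ^ (n - 1)"
    unfolding full_transf_def using card_PiE_prescribed_value[OF _ c c] by simp
  ultimately show thesis
    using that by simp
qed

subsection \<open>Powers with a bounded sum of base and exponent\<close>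

lemma power_le_power_iff_mult_ln_le:
  fixes x y :: real
  assumes "0 < x" "0 < y"
  shows "x ^ a \<le> y ^ b \<longleftrightarrow> real a * ln x \<le> real b * ln y"
  using ln_le_cancel_iff[of "x ^ a" "y ^ b"] assms by (simp add: ln_realpow)

lemma power_diff_base_add_exponent_le_power:
  fixes k N d :: nat
  assumes kN: "real k * ln (real k) \<le> real N" and d: "d < k"
  shows "(k - d) ^ (N + d) \<le> k ^ N"
proof -
  have "real d * ln (real (k - d)) \<le> real d * ln (real k)"
    using d by (intro mult_left_mono) auto
  also have "\<dots> = real k * ln (real k) * (real d / real k)"
    using d by simp
  also have "\<dots> \<le> real N * (real d / real k)"
    using kN by (intro mult_right_mono) auto
  also have "\<dots> \<le> real N * (ln (real k) - ln (real (k - d)))"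
    using ln_diff_le[of "real (k - d)" "real k"] d
    by (intro mult_left_mono) (simp_all add: of_nat_diff field_simps)
  finally have "real (N + d) * ln (real (k - d)) \<le> real N * ln (real k)"
    by (simp add: algebra_simps)
  then have "real (k - d) ^ (N + d) \<le> real k ^ N"
    using d by (subst power_le_power_iff_mult_ln_le) auto
  then show ?thesis
    by (metis of_nat_le_iff of_nat_power)
qed

lemma power_add_base_le_power_add_exponent:
  fixes n d q :: nat
  assumes "3 \<le> n" "q \<le> n"
  shows "(n + d) ^ q \<le> n ^ (q + d)"
proof -
  have "exp 1 \<le> real n"
    using exp_le assms(1) by linarith
  then have ln_n: "1 \<le> ln (real n)"
    using assms(1) by (simp add: ln_ge_iff)
  have "real q * (ln (real (n + d)) - ln (real n)) \<le> real q * (real d / real n)"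
    using ln_diff_le[of "real (n + d)" "real n"] assms(1) by (intro mult_left_mono) auto
  also have "\<dots> = real d * (real q / real n)"
    by simp
  also have "\<dots> \<le> real d * ln (real n)"
  proof (rule mult_left_mono)
    have "real q / real n \<le> 1"
      using assms by simp
    then show "real q / real n \<le> ln (real n)"
      using ln_n by linarith
  qed simp
  finally have "real q * ln (real (n + d)) \<le> real (q + d) * ln (real n)"
    by (simp add: algebra_simps)
  then have "real (n + d) ^ q \<le> real n ^ (q + d)"
    using assms(1) by (subst power_le_power_iff_mult_ln_le) auto
  then show ?thesis
    by (metis of_nat_le_iff of_nat_power)
qed

lemma power_less_power_of_sum_less:
  fixes k n p q :: nat
  assumes k: "2 \<le> k" and kn: "real k * ln (real k) \<le> real n - 1" and pq: "p + q < n + k"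
  shows "p ^ q < n ^ (n - 1)"
proof -
  have "real k - 1 < real k * ln (real k)"
    using ln_diff_less[of 1 "real k"] k by (simp add: field_simps)
  then have "k < n"
    using kn by linarith
  consider "p = 0" | "0 < p" "p \<le> k" | "k \<le> p" "p < n" | "n \<le> p"
    by linarith
  then show ?thesis
  proof cases
    case 1
    then have "p ^ q \<le> 1"
      by (simp add: power_0_left)
    also have "1 < n ^ (n - 1)"
      using k \<open>k < n\<close> by (intro one_less_power) auto
    finally show ?thesis .
  next
    case 2
    then have "p ^ q \<le> p ^ (n - 1 + (k - p))"
      using pq by (intro power_increasing) auto
    also have "\<dots> \<le> k ^ (n - 1)"
      using power_diff_base_add_exponent_le_power[of k "n - 1" "k - p"] 2 kn \<open>k < n\<close>
      by (simp add: of_nat_diff)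
    also have "\<dots> < n ^ (n - 1)"
      using k \<open>k < n\<close> by (intro power_strict_mono) auto
    finally show ?thesis .
  next
    case 3
    then have "p ^ q \<le> p ^ (n - 1)"
      using k pq by (intro power_increasing) auto
    also have "\<dots> < n ^ (n - 1)"
      using 3 k \<open>k < n\<close> by (intro power_strict_mono) auto
    finally show ?thesis .
  next
    case 4
    then obtain d where d: "p = n + d"
      using le_iff_add by blast
    then have "p ^ q \<le> n ^ (q + d)"
      using power_add_base_le_power_add_exponent[of n q d] k \<open>k < n\<close> pq by simp
    also have "\<dots> < n ^ (n - 1)"
      using d k \<open>k < n\<close> pq by (intro power_strict_increasing) auto
    finally show ?thesis .
  qed
qed

theorem theorem5p28:
  fixes k n :: nat and a :: "nat \<Rightarrow> nat"
  assumes "k \<ge> 2"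
    and "int n \<ge> \<lceil>real k * ln (real k)\<rceil> + 1"
    and "a \<in> full_transf n"
    and "transf_rank n a = 1"
  shows "semigroup_degree (full_transf n) (variant_mult n a) \<ge> n + k"
proof (rule ccontr)
  let ?m = "semigroup_degree (full_transf n) (variant_mult n a)"
  assume "\<not> ?m \<ge> n + k"
  have "finite (full_transf n)"
    unfolding full_transf_def by (simp add: finite_PiE)
  then obtain h where "semigroup_embedding (full_transf n) (variant_mult n a)
      (full_transf ?m) (transf_mult ?m) h"
    using semigroup_degree_embedding[OF semigroup_on_variant[OF assms(3)]] by blast
  then obtain p q where pq: "p + q = ?m" "n ^ (n - 1) \<le> p ^ q"
    using rank_1_variant_embedding_bound[OF assms(3,4)] by blast
  have "real k * ln (real k) \<le> real n - 1"
    using assms(2) by linarith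
  moreover have "p + q < n + k"
    using \<open>\<not> ?m \<ge> n + k\<close> pq(1) by linarith
  ultimately have "p ^ q < n ^ (n - 1)"
    by (rule power_less_power_of_sum_less[OF assms(1)])
  then show False
    using pq(2) by linarith
qed

end
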